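(* Let $n\ge1$, let $y\in\mathcal{M}_{n,2}$, and let $q\in\mathbb{R}[x_1,\dots,x_n]$ be a quadratic polynomial. Let $E(q)=\{x\in\mathbb{R}^n:q(x)=0\}$ and $S(q)=\{x\in\mathbb{R}^n:q(x)\ge0\}$. (i) If $E(q)\neq\emptyset$, $M_1(y)\succ0$ and $L_y(q)=0$, then $y\in\mathcal{R}_{n,2}(E(q))$. (ii) If $S(q)\neq\emptyset$, $M_1(y)\succ0$ and $L_y(q)>0$, then $y\in\mathcal{R}_{n,2}(S(q))$.
   Context: "Quadratic" means of total degree two. $\mathcal{M}_{n,2}$ is the set of all real families $y=(y_\alpha)_{\alpha\in\mathbb{Z}_+^n,|\alpha|\le2}$, where $|\alpha|=\alpha_1+\cdots+\alpha_n$. $M_1(y)$ is the $(n+1)\times(n+1)$ real symmetric matrix with rows and columns indexed by $\alpha,\beta\in\mathbb{Z}_+^n$, $|\alpha|,|\beta|\le1$, and $(\alpha,\beta)$ entry $y_{\alpha+\beta}$; $\succ0$ means positive definite. The Riesz functional is $L_y\big(\sum_{|\alpha|\le2}p_\alpha x^\alpha\big)=\sum_{|\alpha|\le2}p_\alpha y_\alpha$. For closed $K\subseteq\mathbb{R}^n$, $\mathcal{R}_{n,2}(K)$ is the set of $y\in\mathcal{M}_{n,2}$ for which there is a positive Borel measure $\mu$ on $\mathbb{R}^n$, supported in $K$, with $y_\alpha=\int x^\alpha\,d\mu(x)$ for all $|\alpha|\le2$. *)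

theory Defs
  imports "HOL-Analysis.Analysis" "HOL-Library.Poly_Mapping" "HOL-Library.FuncSet"
begin

text \<open>
  Polynomials in \<open>n = CARD('n)\<close> variables are finitely supported maps from multi-indices
  to coefficients; addition of multi-indices is pointwise.
\<close>

type_synonym 'n multi_index = "'n \<Rightarrow>\<^sub>0 nat"
type_synonym 'n real_mpoly = "'n multi_index \<Rightarrow>\<^sub>0 real"

definition mdeg :: "'n::finite multi_index \<Rightarrow> nat" where
  "mdeg \<alpha> = (\<Sum>i\<in>UNIV. Poly_Mapping.lookup \<alpha> i)"

definition multi_indices :: "nat \<Rightarrow> 'n::finite multi_index set" where
  "multi_indices d = {\<alpha>. mdeg \<alpha> \<le> d}"

definition monomial_eval :: "'n::finite multi_index \<Rightarrow> real^'n \<Rightarrow> real" where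
  "monomial_eval \<alpha> x = (\<Prod>i\<in>UNIV. (x $ i) ^ Poly_Mapping.lookup \<alpha> i)"

definition mpoly_eval :: "'n::finite real_mpoly \<Rightarrow> real^'n \<Rightarrow> real" where
  "mpoly_eval p x =
     (\<Sum>\<alpha>\<in>Poly_Mapping.keys p. Poly_Mapping.lookup p \<alpha> * monomial_eval \<alpha> x)"

definition total_deg :: "'n::finite real_mpoly \<Rightarrow> nat" where
  "total_deg p = Max (insert 0 (mdeg ` Poly_Mapping.keys p))"

definition quadratic :: "'n::finite real_mpoly \<Rightarrow> bool" where
  "quadratic p \<longleftrightarrow> total_deg p = 2"

text \<open>
  A family indexed by the multi-indices of degree at most \<open>d\<close> is a function that is
  \<open>undefined\<close> at all other multi-indices.
\<close>

definition trunc_moment_seqs :: "nat \<Rightarrow> ('n::finite multi_index \<Rightarrow> real) set" where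
  "trunc_moment_seqs d = multi_indices d \<rightarrow>\<^sub>E UNIV"

definition moment_matrix ::
  "('n::finite multi_index \<Rightarrow> real) \<Rightarrow> 'n multi_index \<Rightarrow> 'n multi_index \<Rightarrow> real" where
  "moment_matrix y \<alpha> \<beta> = y (\<alpha> + \<beta>)"

text \<open>
  Positive definiteness of the real matrix \<open>(A i j)\<close> with rows and columns indexed by the
  finite set \<open>I\<close>; entries outside \<open>I \<times> I\<close> are irrelevant.
\<close>

definition pos_definite_on :: "'i set \<Rightarrow> ('i \<Rightarrow> 'i \<Rightarrow> real) \<Rightarrow> bool" where
  "pos_definite_on I A \<longleftrightarrow>
     (\<forall>i\<in>I. \<forall>j\<in>I. A i j = A j i) \<and>
     (\<forall>v. (\<exists>i\<in>I. v i \<noteq> 0) \<longrightarrow> (\<Sum>i\<in>I. \<Sum>j\<in>I. v i * A i j * v j) > 0)"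

definition riesz ::
  "nat \<Rightarrow> ('n::finite multi_index \<Rightarrow> real) \<Rightarrow> 'n real_mpoly \<Rightarrow> real" where
  "riesz d y p = (\<Sum>\<alpha>\<in>multi_indices d. Poly_Mapping.lookup p \<alpha> * y \<alpha>)"

text \<open>
  Intended for closed \<open>K\<close>: then \<open>- K\<close> is Borel, and it is a null set iff the support of
  the measure is contained in \<open>K\<close>.
\<close>

definition representable ::
  "nat \<Rightarrow> (real^'n) set \<Rightarrow> ('n::finite multi_index \<Rightarrow> real) set" where
  "representable d K =
     {y \<in> trunc_moment_seqs d.
        \<exists>\<mu> :: (real^'n) measure.
          sets \<mu> = sets borel \<and> emeasure \<mu> (- K) = 0 \<and>
          (\<forall>\<alpha>\<in>multi_indices d. has_bochner_integral \<mu> (monomial_eval \<alpha>) (y \<alpha>))}"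

definition zero_set :: "'n::finite real_mpoly \<Rightarrow> (real^'n) set" where
  "zero_set q = {x. mpoly_eval q x = 0}"

definition nonneg_set :: "'n::finite real_mpoly \<Rightarrow> (real^'n) set" where
  "nonneg_set q = {x. mpoly_eval q x \<ge> 0}"

lemma finite_multi_indices: "finite (multi_indices d :: 'n::finite multi_index set)"
proof -
  have "Poly_Mapping.lookup ` (multi_indices d :: 'n multi_index set) \<subseteq> PiE UNIV (\<lambda>_. {..d})"
  proof (clarsimp simp: multi_indices_def PiE_UNIV_domain)
    fix \<alpha> :: "'n multi_index" and i
    assume "mdeg \<alpha> \<le> d"
    moreover have "Poly_Mapping.lookup \<alpha> i \<le> mdeg \<alpha>"
      unfolding mdeg_def by (rule member_le_sum) auto
    ultimately show "Poly_Mapping.lookup \<alpha> i \<le> d" by linarith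
  qed
  then have "finite (Poly_Mapping.lookup ` (multi_indices d :: 'n multi_index set))"
    by (rule finite_subset) (intro finite_PiE; simp)
  then show ?thesis
    by (rule finite_imageD) (simp add: inj_on_def poly_mapping_eqI)
qed

lemma continuous_on_mpoly_eval: "continuous_on A (mpoly_eval q)"
  unfolding mpoly_eval_def monomial_eval_def by (intro continuous_intros)

lemma closed_zero_set: "closed (zero_set q)"
  unfolding zero_set_def
  by (intro closed_Collect_eq continuous_on_mpoly_eval continuous_on_const)

lemma closed_nonneg_set: "closed (nonneg_set q)"
  unfolding nonneg_set_def
  by (intro closed_Collect_le continuous_on_mpoly_eval continuous_on_const)

end

theory Submission
  imports Defs
begin

text \<open>
  Adding a coordinate \<open>v\<^sub>0\<close>, indexed by \<open>None\<close> and equal to \<open>1\<close> at the points of \<open>\<real>\<^sup>n\<close>, turns a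
  quadratic polynomial \<open>q\<close> into a quadratic form with matrix \<open>Q\<close>, and \<open>y\<close> into \<open>X = M\<^sub>1(y)\<close>. In
  the Frobenius inner product, \<open>q(x) = Q \<bullet> vv\<^sup>T\<close> for \<open>v = (1, x)\<close>, and \<open>L\<^sub>y(q) = Q \<bullet> X\<close>.
  Since \<open>(t, tx)\<close> has \<open>vv\<^sup>T = t\<^sup>2 (1, x)(1, x)\<^sup>T\<close>, a finitely atomic measure on \<open>{q = 0}\<close>, or on
  \<open>{q \<ge> 0}\<close>, with moments \<open>y\<close> is the same as a way to write \<open>X\<close> as a convex combination of
  matrices \<open>vv\<^sup>T\<close> with \<open>v\<^sub>0 \<noteq> 0\<close> and \<open>Q \<bullet> vv\<^sup>T \<in> T\<close>, where \<open>T\<close> is \<open>{0}\<close> or \<open>[0, \<infinity>)\<close>;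
  weights are absorbed by the scaling of \<open>v\<close>. Let \<open>C\<close> be the convex hull of these matrices.

  If the condition \<open>v\<^sub>0 \<noteq> 0\<close> is ignored, then the decomposition exists for every positive
  semidefinite \<open>Y\<close> with \<open>Q \<bullet> Y \<in> T\<close>: split \<open>Y\<close> into matrices \<open>pp\<^sup>T\<close> in any way and rotate pairs
  of vectors on which the form has opposite signs until one of the two becomes isotropic
  (\<open>psd_mem_convex_hull\<close>). The vectors with \<open>v\<^sub>0 = 0\<close> are limits of admissible ones
  (\<open>isotropic_in_closure\<close>, \<open>nonneg_in_closure\<close>), so every such \<open>Y\<close> lies in the closure of \<open>C\<close>.
  This rests on two properties of the form. It takes both signs if \<open>Q \<bullet> X = 0\<close>, and positive
  values if \<open>Q \<bullet> X > 0\<close>, because \<open>X\<close> is definite (\<open>pos_def_exists_neg\<close>). And for \<open>T = {0}\<close> it must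
  not vanish identically on the hyperplane at infinity \<open>v\<^sub>0 = 0\<close>, which is where the degree of \<open>q\<close>
  has to be two and not less (\<open>quadratic_form_at_infinity\<close>): for \<open>q = x\<^sub>1\<close> the conclusion fails,
  since a measure on \<open>{x\<^sub>1 = 0}\<close> has a singular moment matrix.

  It remains to remove the closure, and here positive definiteness enters: all matrices close
  to \<open>X\<close> in the affine hull of \<open>C\<close> are still positive semidefinite with \<open>Q \<bullet> Y \<in> T\<close>, so \<open>X\<close> is
  a relative interior point of the closure of \<open>C\<close>. A convex set and its closure have the same
  relative interior, whence \<open>X \<in> C\<close> (\<open>pos_def_mem_convex_hull\<close>).
\<close>

section \<open>Quadratic forms as Frobenius products with rank-one matrices\<close>

definition outer :: "real^'k \<Rightarrow> real^'k^'k" where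
  "outer v = (\<chi> i j. v $ i * v $ j)"

lemma outer_nth [simp]: "outer v $ i $ j = v $ i * v $ j"
  by (simp add: outer_def)

lemma outer_scaleR: "outer (c *\<^sub>R v) = c\<^sup>2 *\<^sub>R outer v"
  by (simp add: vec_eq_iff power2_eq_square)

lemma outer_0 [simp]: "outer 0 = 0"
  by (simp add: vec_eq_iff)

text \<open>
  Against a matrix \<open>Q\<close> this is the parallelogram law for the quadratic form of \<open>Q\<close>; it compares
  values near a zero \<open>v\<close> of the form with values at \<open>u\<close>, without any bilinear form.
\<close>

lemma outer_parallelogram: "outer (v + u) + outer (v - u) = 2 *\<^sub>R outer v + 2 *\<^sub>R outer u"
  by (simp add: vec_eq_iff algebra_simps)

lemma continuous_on_outer [continuous_intros]:
  "continuous_on S f \<Longrightarrow> continuous_on S (\<lambda>x. outer (f x))"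
  unfolding outer_def by (intro continuous_intros)

lemma inner_outer: "A \<bullet> outer v = v \<bullet> (A *v v)"
  by (simp add: inner_vec_def matrix_vector_mult_def sum_distrib_left mult_ac)

lemma norm_outer: "norm (outer v) = (norm v)\<^sup>2"
proof -
  have "outer v \<bullet> outer v = (v \<bullet> v)\<^sup>2"
    by (simp add: inner_vec_def power2_eq_square sum_product mult_ac)
  then show ?thesis
    by (simp add: norm_eq_sqrt_inner)
qed

lemma inner_outer_add_axis:
  fixes X :: "real^'k^'k"
  assumes "\<And>i j. X $ i $ j = X $ j $ i"
  shows "X \<bullet> outer (v + c *\<^sub>R axis k 1) = X \<bullet> outer v + 2 * c * (X $ k \<bullet> v) + c\<^sup>2 * X $ k $ k"
proof -
  have *: "axis k 1 \<bullet> (X *v w) = X $ k \<bullet> w" for w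
    by (subst inner_axis') (simp add: matrix_vector_mult_def inner_vec_def)
  have **: "v \<bullet> (X *v axis k 1) = X $ k \<bullet> v"
    using assms by (simp add: matrix_vector_mult_basis column_def inner_vec_def mult.commute)
  show ?thesis
    unfolding inner_outer
    by (simp add: matrix_vector_right_distrib matrix_vector_mult_scaleR inner_add_left
        inner_add_right * ** inner_axis power2_eq_square algebra_simps)
qed

section \<open>Rank-one decompositions of positive semidefinite matrices\<close>

text \<open>
  Cholesky elimination. If the pivot \<open>a = X\<^sub>k\<^sub>k\<close> is positive, subtracting \<open>rr\<^sup>T/a\<close>, with \<open>r\<close> the
  \<open>k\<close>-th row, clears row and column \<open>k\<close>; the remainder is still semidefinite because its form
  at \<open>v\<close> is the minimum of the form of \<open>X\<close> on the line \<open>v + \<real>e\<^sub>k\<close>. If the pivot vanishes,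
  the form is affine along such a line, so semidefiniteness forces the whole row to vanish.
\<close>

lemma psd_eq_sum_outer:
  fixes X :: "real^'k^'k"
  assumes "finite J" and "\<And>i j. X $ i $ j = X $ j $ i" and "\<And>v. 0 \<le> X \<bullet> outer v"
    and "\<And>i j. i \<notin> J \<Longrightarrow> X $ i $ j = 0"
  shows "\<exists>p. X = (\<Sum>j\<in>J. outer (p j))"
  using assms
proof (induction J arbitrary: X rule: finite_induct)
  case empty
  then show ?case by (simp add: vec_eq_iff)
next
  case (insert k J)
  note sym = insert.prems(1) and psd = insert.prems(2) and supp = insert.prems(3)
  define r where "r = X $ k"
  define a where "a = X $ k $ k"
  have shift: "0 \<le> X \<bullet> outer v + 2 * c * (r \<bullet> v) + c\<^sup>2 * a" for v c
    using psd[of "v + c *\<^sub>R axis k 1"] inner_outer_add_axis[OF sym, of v c k]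
    by (simp add: r_def a_def)
  have "a \<ge> 0"
    using shift[of 0 1] by simp
  show ?case
  proof (cases "a = 0")
    case True
    have "r \<bullet> r = 0"
    proof (rule ccontr)
      assume "r \<bullet> r \<noteq> 0"
      \<comment> \<open>this step along \<open>e\<^sub>k\<close> would bring the form down to \<open>-1\<close>\<close>
      then show False
        using shift[of r "- (X \<bullet> outer r + 1) / (2 * (r \<bullet> r))"] True by (simp add: field_simps)
    qed
    then have row: "X $ k $ j = 0" for j
      by (simp add: r_def)
    have "X $ i $ j = 0" if "i \<notin> J" for i j
      using that supp[of i j] row by (cases "i = k") auto
    then obtain p where p: "X = (\<Sum>j\<in>J. outer (p j))"
      using insert.IH[of X] sym psd by blast
    have "(\<Sum>j\<in>J. outer ((p(k := 0)) j)) = (\<Sum>j\<in>J. outer (p j))"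
      using insert.hyps by (intro sum.cong) auto
    then have "X = (\<Sum>j\<in>insert k J. outer ((p(k := 0)) j))"
      using p insert.hyps by simp
    then show ?thesis by blast
  next
    case False
    with \<open>a \<ge> 0\<close> have a: "a > 0" by simp
    define p0 where "p0 = (1 / sqrt a) *\<^sub>R r"
    have p0: "outer p0 = (1 / a) *\<^sub>R outer r"
      using a by (simp add: p0_def outer_scaleR power_divide)
    define X' where "X' = X - outer p0"
    have X'_nth: "X' $ i $ j = X $ i $ j - r $ i * r $ j / a" for i j
      by (simp add: X'_def p0)
    have "0 \<le> X' \<bullet> outer v" for v
    proof -
      have "outer r \<bullet> outer v = (r \<bullet> v)\<^sup>2"
        by (simp add: inner_vec_def power2_eq_square sum_product mult_ac)
      then have "X' \<bullet> outer v = X \<bullet> outer v - (r \<bullet> v)\<^sup>2 / a"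
        by (simp add: X'_def p0 inner_diff_left)
      \<comment> \<open>completing the square: \<open>c = - (r \<bullet> v) / a\<close> minimises the form on \<open>v + \<real>e\<^sub>k\<close>\<close>
      also have "\<dots> = X \<bullet> outer v + 2 * (- (r \<bullet> v) / a) * (r \<bullet> v) + (- (r \<bullet> v) / a)\<^sup>2 * a"
        using a by (simp add: field_simps power2_eq_square)
      finally show ?thesis using shift[of v "- (r \<bullet> v) / a"] by simp
    qed
    moreover have "X' $ i $ j = X' $ j $ i" for i j
      using sym[of i j] by (simp add: X'_nth)
    moreover have "X' $ i $ j = 0" if "i \<notin> J" for i j
    proof (cases "i = k")
      case True
      then show ?thesis using a by (simp add: X'_nth) (simp add: r_def a_def)
    next
      case False
      then have "X $ i $ j = 0" "r $ i = 0"
        using supp that sym[of i k] by (auto simp: r_def)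
      then show ?thesis by (simp add: X'_nth)
    qed
    ultimately obtain p where p: "X' = (\<Sum>j\<in>J. outer (p j))"
      using insert.IH[of X'] by blast
    have "(\<Sum>j\<in>J. outer ((p(k := p0)) j)) = (\<Sum>j\<in>J. outer (p j))"
      using insert.hyps by (intro sum.cong) auto
    then have "X = (\<Sum>j\<in>insert k J. outer ((p(k := p0)) j))"
      using p insert.hyps by (simp add: X'_def algebra_simps)
    then show ?thesis by blast
  qed
qed

lemma psd_eq_sum_outer_UNIV:
  fixes X :: "real^'k^'k"
  assumes "\<And>i j. X $ i $ j = X $ j $ i" and "\<And>v. 0 \<le> X \<bullet> outer v"
  shows "\<exists>p :: 'k \<Rightarrow> real^'k. X = (\<Sum>j\<in>UNIV. outer (p j))"
  by (rule psd_eq_sum_outer) (use assms in auto)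

text \<open>
  Rotating the pair \<open>(a, b)\<close> by any angle preserves \<open>aa\<^sup>T + bb\<^sup>T\<close>. The first vector moves from
  \<open>a\<close> to \<open>b\<close> as the angle goes from \<open>0\<close> to \<open>\<pi>/2\<close>, so the form vanishes on the way.
\<close>

lemma rotate_to_isotropic:
  assumes "Q \<bullet> outer a > 0" and "Q \<bullet> outer b < 0"
  obtains c d where "Q \<bullet> outer c = 0" and "outer c + outer d = outer a + outer b"
proof -
  define f where "f \<theta> = Q \<bullet> outer (cos \<theta> *\<^sub>R a + sin \<theta> *\<^sub>R b)" for \<theta>
  have "continuous_on {0..pi/2} f"
    unfolding f_def by (intro continuous_intros)
  then obtain \<theta> where \<theta>: "f \<theta> = 0"
    using IVT2'[of f "pi/2" 0 0] assms by (auto simp: f_def)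
  have "(cos \<theta>)\<^sup>2 + (sin \<theta>)\<^sup>2 = 1"
    by simp
  then have *: "cos \<theta> * cos \<theta> = 1 - sin \<theta> * sin \<theta>"
    unfolding power2_eq_square by linarith
  have "outer (cos \<theta> *\<^sub>R a + sin \<theta> *\<^sub>R b) + outer (cos \<theta> *\<^sub>R b - sin \<theta> *\<^sub>R a) = outer a + outer b"
  proof -
    have "(cos \<theta> * x + sin \<theta> * z) * (cos \<theta> * x' + sin \<theta> * z')
        + (cos \<theta> * z - sin \<theta> * x) * (cos \<theta> * z' - sin \<theta> * x') = x * x' + z * z'"
      for x x' z z' :: real
      using * by algebra
    then show ?thesis by (simp add: vec_eq_iff)
  qed
  then show ?thesis
    using that \<theta> unfolding f_def by blast
qed

text \<open>
  As long as some \<open>p\<^sub>j\<close> violates the constraint, the condition on the sum provides \<open>p\<^sub>i\<close> and \<open>p\<^sub>j\<close>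
  on which the form is positive and negative. Rotating this pair makes one of them isotropic, so
  the number of non-isotropic vectors drops; this number, and not the number of violations, is
  the induction measure, since nothing is known about the sign of the form on the other one.
\<close>

lemma sum_outer_mem_convex_hull:
  fixes p :: "'i \<Rightarrow> real^'k"
  assumes "T = {0} \<or> T = {0..}" and "finite I" and "Q \<bullet> (\<Sum>i\<in>I. outer (p i)) \<in> T"
  shows "(\<Sum>i\<in>I. outer (p i)) \<in> convex hull (outer ` {v. Q \<bullet> outer v \<in> T})"
  using assms(3)
proof (induction "card {i \<in> I. Q \<bullet> outer (p i) \<noteq> 0}" arbitrary: p rule: less_induct)
  case less
  have sum: "(\<Sum>i\<in>I. Q \<bullet> outer (p i)) \<in> T"
    using less.prems by (simp add: inner_sum_right)
  show ?case
  proof (cases "\<forall>i\<in>I. Q \<bullet> outer (p i) \<in> T")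
    case True
    show ?thesis
    proof (cases "I = {}")
      case True
      have "outer 0 \<in> outer ` {v. Q \<bullet> outer v \<in> T}"
        using assms(1) by (intro imageI) auto
      then show ?thesis
        using True by (simp add: hull_inc)
    next
      case False
      \<comment> \<open>a sum is a convex combination with equal weights of vectors rescaled by \<open>\<surd>N\<close>\<close>
      let ?N = "real (card I)"
      have N: "?N > 0"
        using False \<open>finite I\<close> by (simp add: card_gt_0_iff)
      have "outer (sqrt ?N *\<^sub>R p i) \<in> convex hull (outer ` {v. Q \<bullet> outer v \<in> T})" if "i \<in> I" for i
        using True that N assms(1) by (intro hull_inc imageI) (auto simp: outer_scaleR)
      then have "(\<Sum>i\<in>I. (1 / ?N) *\<^sub>R outer (sqrt ?N *\<^sub>R p i))
          \<in> convex hull (outer ` {v. Q \<bullet> outer v \<in> T})"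
        using \<open>finite I\<close> N by (intro convex_sum) auto
      then show ?thesis
        using N by (simp add: outer_scaleR)
    qed
  next
    case False
    have "\<exists>i\<in>I. Q \<bullet> outer (p i) < 0"
    proof (rule ccontr)
      assume "\<not> ?thesis"
      then have nn: "\<forall>i\<in>I. 0 \<le> Q \<bullet> outer (p i)" by force
      with False assms(1) have "T = {0}" by auto
      with sum nn have "\<forall>i\<in>I. Q \<bullet> outer (p i) = 0"
        using sum_nonneg_eq_0_iff[OF \<open>finite I\<close>, of "\<lambda>i. Q \<bullet> outer (p i)"] by simp
      with False \<open>T = {0}\<close> show False by simp
    qed
    then obtain j where j: "j \<in> I" "Q \<bullet> outer (p j) < 0" by blast
    have "\<exists>i\<in>I. Q \<bullet> outer (p i) > 0"
    proof (rule ccontr)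
      assume "\<not> ?thesis"
      then have "\<forall>i\<in>I. Q \<bullet> outer (p i) \<le> 0" by force
      with j \<open>finite I\<close> have "(\<Sum>i\<in>I. Q \<bullet> outer (p i)) < (\<Sum>i\<in>I. 0)"
        by (intro sum_strict_mono_ex1) auto
      with sum assms(1) show False by auto
    qed
    then obtain i where i: "i \<in> I" "Q \<bullet> outer (p i) > 0" by blast
    obtain c d where cd: "Q \<bullet> outer c = 0" "outer c + outer d = outer (p i) + outer (p j)"
      using rotate_to_isotropic[OF i(2) j(2)] .
    define p' where "p' = p(i := c, j := d)"
    have "i \<noteq> j" using i j by auto
    have split: "(\<Sum>l\<in>I. outer (f l)) = outer (f i) + outer (f j) + (\<Sum>l\<in>I - {i} - {j}. outer (f l))"
      for f :: "'i \<Rightarrow> real^'k"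
      using i j \<open>i \<noteq> j\<close> \<open>finite I\<close> by (simp add: sum.remove[of I i] sum.remove[of "I - {i}" j])
    have "(\<Sum>l\<in>I - {i} - {j}. outer (p' l)) = (\<Sum>l\<in>I - {i} - {j}. outer (p l))"
      by (intro sum.cong) (auto simp: p'_def)
    then have eq: "(\<Sum>l\<in>I. outer (p l)) = (\<Sum>l\<in>I. outer (p' l))"
      unfolding split[of p] split[of p'] using cd \<open>i \<noteq> j\<close> by (simp add: p'_def)
    have "{l \<in> I. Q \<bullet> outer (p' l) \<noteq> 0} \<subseteq> {l \<in> I. Q \<bullet> outer (p l) \<noteq> 0} - {i}"
      using cd j \<open>i \<noteq> j\<close> by (auto simp: p'_def)
    moreover have "i \<in> {l \<in> I. Q \<bullet> outer (p l) \<noteq> 0}"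
      using i by simp
    ultimately have "card {l \<in> I. Q \<bullet> outer (p' l) \<noteq> 0} < card {l \<in> I. Q \<bullet> outer (p l) \<noteq> 0}"
      using \<open>finite I\<close> by (intro psubset_card_mono) auto
    then show ?thesis
      using less.hyps[of p'] less.prems eq by simp
  qed
qed

lemma psd_mem_convex_hull:
  fixes X Q :: "real^'k^'k"
  assumes "T = {0} \<or> T = {0..}" and "\<And>i j. X $ i $ j = X $ j $ i" and "\<And>v. 0 \<le> X \<bullet> outer v"
    and "Q \<bullet> X \<in> T"
  shows "X \<in> convex hull (outer ` {v. Q \<bullet> outer v \<in> T})"
proof -
  obtain p where "X = (\<Sum>j\<in>UNIV. outer (p (j :: 'k)))"
    using psd_eq_sum_outer_UNIV[OF assms(2,3)] by blast
  then show ?thesis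
    using sum_outer_mem_convex_hull[OF assms(1), of UNIV Q p] assms(4) by simp
qed

section \<open>From the closure to the convex hull\<close>

text \<open>
  Positive definite matrices are interior to the semidefinite cone: the radius is the minimum of
  the form on the compact unit sphere, where each \<open>vv\<^sup>T\<close> has norm \<open>1\<close>.
\<close>

lemma pos_def_nbhd:
  fixes X :: "real^'k^'k"
  assumes "\<And>v. v \<noteq> 0 \<Longrightarrow> 0 < X \<bullet> outer v"
  obtains \<delta> where "\<delta> > 0" and "\<And>Y v. dist X Y < \<delta> \<Longrightarrow> 0 \<le> Y \<bullet> outer v"
proof -
  have "compact (sphere (0 :: real^'k) 1)" "sphere (0 :: real^'k) 1 \<noteq> {}"
    by auto
  moreover have "continuous_on (sphere 0 1) (\<lambda>v. X \<bullet> outer v)"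
    by (intro continuous_intros)
  ultimately obtain w where w: "w \<in> sphere 0 1" "\<And>v. v \<in> sphere 0 1 \<Longrightarrow> X \<bullet> outer w \<le> X \<bullet> outer v"
    using continuous_attains_inf[of "sphere 0 1" "\<lambda>v. X \<bullet> outer v"] by blast
  show ?thesis
  proof
    show "X \<bullet> outer w > 0"
      using w by (intro assms) auto
    fix Y :: "real^'k^'k" and v :: "real^'k"
    assume Y: "dist X Y < X \<bullet> outer w"
    show "0 \<le> Y \<bullet> outer v"
    proof (cases "v = 0")
      case False
      define u where "u = (1 / norm v) *\<^sub>R v"
      have u: "norm u = 1" "v = norm v *\<^sub>R u"
        using False by (auto simp: u_def)
      have "(X - Y) \<bullet> outer u \<le> dist X Y"
        using norm_cauchy_schwarz[of "X - Y" "outer u"] u by (simp add: norm_outer dist_norm)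
      moreover have "X \<bullet> outer w \<le> X \<bullet> outer u"
        using w u by simp
      ultimately have "0 \<le> Y \<bullet> outer u"
        using Y by (simp add: inner_diff_left)
      then show ?thesis
        by (subst u(2)) (simp add: outer_scaleR)
    qed simp
  qed
qed

text \<open>
  All matrices in the affine hull of the convex hull are symmetric and, if \<open>T = {0}\<close>, satisfy
  \<open>Q \<bullet> Y = 0\<close>; for \<open>T = [0, \<infinity>)\<close> the strict inequality \<open>Q \<bullet> X > 0\<close> survives small perturbations
  instead. In both cases those close to \<open>X\<close> are in the closure of the convex hull, which makes
  \<open>X\<close> a relative interior point of the closure, hence of the hull itself.
\<close>

lemma pos_def_mem_convex_hull:
  fixes X Q :: "real^'k^'k"
    and k :: "'k" and T :: "real set"
  defines "W \<equiv> {v. v $ k \<noteq> 0 \<and> Q \<bullet> outer v \<in> T}"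
  assumes sym: "\<And>i j. X $ i $ j = X $ j $ i" and pos: "\<And>v. v \<noteq> 0 \<Longrightarrow> 0 < X \<bullet> outer v"
    and T: "T = {0} \<and> Q \<bullet> X = 0 \<or> T = {0..} \<and> 0 < Q \<bullet> X"
    and dense: "\<And>v. Q \<bullet> outer v \<in> T \<Longrightarrow> v \<in> closure W"
  shows "X \<in> convex hull (outer ` W)"
proof -
  let ?C = "convex hull (outer ` W)"
  define L where "L = {Y :: real^'k^'k. (\<forall>i j. Y $ i $ j = Y $ j $ i) \<and> (T = {0} \<longrightarrow> Q \<bullet> Y = 0)}"
  have T': "T = {0} \<or> T = {0..}" using T by auto
  have "outer ` {v. Q \<bullet> outer v \<in> T} \<subseteq> outer ` closure W"
    using dense by auto
  also have "\<dots> \<subseteq> closure (outer ` W)"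
    by (intro image_closure_subset closure_subset closed_closure continuous_intros)
  also have "\<dots> \<subseteq> closure ?C"
    by (intro closure_mono hull_subset)
  finally have "convex hull (outer ` {v. Q \<bullet> outer v \<in> T}) \<subseteq> closure ?C"
    by (intro hull_minimal convex_closure convex_convex_hull)
  then have in_closure: "Y \<in> closure ?C"
    if "\<And>i j. Y $ i $ j = Y $ j $ i" "\<And>v. 0 \<le> Y \<bullet> outer v" "Q \<bullet> Y \<in> T" for Y
    using psd_mem_convex_hull[OF T' that] by blast
  have "subspace L"
    by (auto simp: subspace_def L_def inner_add_right)
  moreover have "outer ` W \<subseteq> L"
    by (auto simp: L_def W_def)
  ultimately have "closure ?C \<subseteq> L"
    by (intro closure_minimal hull_minimal closed_subspace subspace_imp_convex)
  then have aff: "affine hull (closure ?C) \<subseteq> L"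
    using \<open>subspace L\<close> by (intro hull_minimal subspace_imp_affine)
  obtain \<delta> where \<delta>: "\<delta> > 0" "\<And>Y v. dist X Y < \<delta> \<Longrightarrow> 0 \<le> Y \<bullet> outer v"
    using pos_def_nbhd[OF pos] by blast
  obtain \<epsilon> where \<epsilon>: "\<epsilon> > 0" "\<And>Y. Y \<in> L \<Longrightarrow> dist X Y < \<epsilon> \<Longrightarrow> Q \<bullet> Y \<in> T"
  proof (cases "T = {0}")
    case True
    then show ?thesis
      using that[of 1] by (simp add: L_def)
  next
    case False
    then have *: "T = {0..}" "0 < Q \<bullet> X" using T by auto
    have "open {Y. 0 < Q \<bullet> Y}"
      by (intro open_Collect_less continuous_intros)
    then obtain \<epsilon> where "\<epsilon> > 0" "ball X \<epsilon> \<subseteq> {Y. 0 < Q \<bullet> Y}"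
      using *(2) by (auto simp: open_contains_ball)
    then show ?thesis
      using *(1) by (intro that[of \<epsilon>]) (auto intro: less_imp_le)
  qed
  have "ball X (min \<delta> \<epsilon>) \<inter> affine hull (closure ?C) \<subseteq> closure ?C"
  proof
    fix Y assume "Y \<in> ball X (min \<delta> \<epsilon>) \<inter> affine hull (closure ?C)"
    then have "dist X Y < \<delta>" "dist X Y < \<epsilon>" "Y \<in> L"
      using aff by auto
    then show "Y \<in> closure ?C"
      using \<delta>(2) \<epsilon>(2) by (intro in_closure) (auto simp: L_def)
  qed
  moreover have "X \<in> closure ?C"
    using T sym \<delta> by (intro in_closure) auto
  ultimately have "X \<in> rel_interior (closure ?C)"
    unfolding mem_rel_interior_ball using \<delta>(1) \<epsilon>(1) by (intro conjI exI[of _ "min \<delta> \<epsilon>"]) auto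
  also have "rel_interior (closure ?C) = rel_interior ?C"
    by (intro convex_rel_interior_closure convex_convex_hull)
  finally show ?thesis
    using rel_interior_subset by blast
qed

section \<open>Approximation by vectors off a coordinate hyperplane\<close>

text \<open>
  The parameter \<open>s\<close>, in practice \<open>1\<close> or \<open>-1\<close>, selects one of the two halves into which the
  hyperplane \<open>w\<^sub>k = 0\<close> cuts the ball; points of the hyperplane are limits of points \<open>w + t s e\<^sub>k\<close>
  with \<open>t > 0\<close>.
\<close>

lemma nonneg_on_half_ball:
  fixes v :: "real^'k"
  assumes pos: "\<And>w. w \<in> ball v e \<Longrightarrow> 0 < s * w $ k \<Longrightarrow> 0 \<le> Q \<bullet> outer w"
    and "s \<noteq> 0" and w: "w \<in> ball v e" "0 \<le> s * w $ k"
  shows "0 \<le> Q \<bullet> outer w"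
proof (rule tendsto_lowerbound)
  let ?g = "\<lambda>t. w + (t * s) *\<^sub>R axis k 1"
  have g: "(?g \<longlongrightarrow> w) (at_right 0)"
    by (auto intro!: tendsto_eq_intros)
  have "isCont (\<lambda>x. Q \<bullet> outer x) w"
    using continuous_on_eq_continuous_at[of UNIV "\<lambda>x. Q \<bullet> outer x"] by (simp add: continuous_intros)
  then show "((\<lambda>t. Q \<bullet> outer (?g t)) \<longlongrightarrow> Q \<bullet> outer w) (at_right 0)"
    using g by (rule isCont_tendsto_compose)
  have "eventually (\<lambda>t. ?g t \<in> ball v e) (at_right 0)"
    using g w(1) by (intro topological_tendstoD) auto
  moreover have "eventually (\<lambda>t. 0 < t) (at_right (0::real))"
    by (rule eventually_at_right_less)
  ultimately show "eventually (\<lambda>t. 0 \<le> Q \<bullet> outer (?g t)) (at_right 0)"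
  proof eventually_elim
    case (elim t)
    have "0 < t * (s * s)"
      using elim \<open>s \<noteq> 0\<close> not_real_square_gt_zero[of s] by (simp add: zero_less_mult_iff)
    then have "0 < s * ?g t $ k"
      using w(2) by (simp add: algebra_simps)
    then show ?case
      using elim pos by blast
  qed
qed simp

text \<open>
  An open half ball is convex, hence connected, so a form without zeros in it has constant sign;
  by continuity this sign persists, weakly, on the flat part of the boundary.
\<close>

lemma half_ball_sign:
  fixes v :: "real^'k"
  assumes no_zero: "\<And>w. w \<in> ball v e \<Longrightarrow> w $ k \<noteq> 0 \<Longrightarrow> Q \<bullet> outer w \<noteq> 0" and "s \<noteq> 0"
  obtains \<sigma> :: real where "\<sigma> = 1 \<or> \<sigma> = -1"
    and "\<And>w. w \<in> ball v e \<Longrightarrow> 0 \<le> s * w $ k \<Longrightarrow> 0 \<le> \<sigma> * (Q \<bullet> outer w)"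
proof -
  let ?U = "ball v e \<inter> {w. 0 < s * w $ k}"
  have "{w :: real^'k. 0 < s * w $ k} = {w. 0 < (s *\<^sub>R axis k 1) \<bullet> w}"
    by (simp add: inner_axis')
  then have "convex ?U"
    by (simp only: convex_Int convex_ball convex_halfspace_gt)
  then have conn: "connected ((\<lambda>w. Q \<bullet> outer w) ` ?U)"
    by (intro connected_continuous_image convex_connected continuous_intros)
  have "(\<forall>w\<in>?U. 0 \<le> Q \<bullet> outer w) \<or> (\<forall>w\<in>?U. Q \<bullet> outer w \<le> 0)"
  proof (rule ccontr)
    assume "\<not> ?thesis"
    then obtain a b where "a \<in> ?U" "b \<in> ?U" "Q \<bullet> outer a < 0" "0 < Q \<bullet> outer b"
      by (auto simp: not_le)
    then have "0 \<in> (\<lambda>w. Q \<bullet> outer w) ` ?U"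
      using connectedD_interval[OF conn, of "Q \<bullet> outer a" "Q \<bullet> outer b" 0] by auto
    then show False
      using no_zero by force
  qed
  then show ?thesis
  proof
    assume "\<forall>w\<in>?U. 0 \<le> Q \<bullet> outer w"
    then show ?thesis
      using nonneg_on_half_ball[of v e s k Q] \<open>s \<noteq> 0\<close> by (intro that[of 1]) auto
  next
    assume "\<forall>w\<in>?U. Q \<bullet> outer w \<le> 0"
    then show ?thesis
      using nonneg_on_half_ball[of v e s k "- Q"] \<open>s \<noteq> 0\<close> by (intro that[of "-1"]) auto
  qed
qed

text \<open>
  A form that has a local minimum \<open>0\<close> at \<open>v\<close> along the directions in \<open>S\<close> is nonnegative on \<open>S\<close>:
  by the parallelogram law the values at \<open>v + tu\<close> and \<open>v - tu\<close> add up to \<open>2 t\<^sup>2\<close> times the value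
  at \<open>u\<close>.
\<close>

lemma nonneg_near_zero_imp_nonneg:
  fixes v :: "real^'k"
  assumes "subspace S" and "0 < e" and zero: "Q \<bullet> outer v = 0"
    and loc: "\<And>u. u \<in> S \<Longrightarrow> v + u \<in> ball v e \<Longrightarrow> 0 \<le> Q \<bullet> outer (v + u)"
    and u: "u \<in> S"
  shows "0 \<le> Q \<bullet> outer u"
proof -
  define t where "t = e / (2 * (norm u + 1))"
  have t: "t > 0"
    using \<open>0 < e\<close> by (simp add: t_def add_nonneg_pos)
  have "t * norm u \<le> t * (norm u + 1)"
    using t by simp
  also have "\<dots> = e / 2"
    by (simp add: t_def field_simps add_nonneg_eq_0_iff)
  finally have small: "norm (t *\<^sub>R u) < e"
    using t \<open>0 < e\<close> by simp
  have "0 \<le> Q \<bullet> outer (v + t *\<^sub>R u)" "0 \<le> Q \<bullet> outer (v + - (t *\<^sub>R u))"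
    using small u \<open>subspace S\<close> by (intro loc; auto simp: dist_norm intro: subspace_mul subspace_neg)+
  then have "0 \<le> Q \<bullet> (outer (v + t *\<^sub>R u) + outer (v - t *\<^sub>R u))"
    by (simp add: inner_add_right)
  also have "\<dots> = 2 * t\<^sup>2 * (Q \<bullet> outer u)"
    unfolding outer_parallelogram by (simp add: zero outer_scaleR inner_add_right)
  finally show ?thesis
    using t by (simp add: zero_le_mult_iff)
qed

text \<open>
  Suppose that no zero off the hyperplane is close to \<open>v\<close>, so that \<open>v\<close> is in the hyperplane and
  the form has a sign on each half of a small ball around \<open>v\<close>. If the signs agree, \<open>v\<close> is a local
  extremum, and the form is semidefinite, against \<open>a\<close> and \<open>b\<close>. If they differ, the form vanishes
  on the part of the hyperplane near \<open>v\<close>, hence on all of it, against \<open>w\<close>.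
\<close>

lemma isotropic_in_closure:
  fixes v :: "real^'k"
  assumes indef: "0 < Q \<bullet> outer a" "Q \<bullet> outer b < 0"
    and nz: "w $ k = 0" "Q \<bullet> outer w \<noteq> 0"
    and zero: "Q \<bullet> outer v = 0"
  shows "v \<in> closure {w. w $ k \<noteq> 0 \<and> Q \<bullet> outer w = 0}"
proof (rule ccontr)
  assume "v \<notin> closure {w. w $ k \<noteq> 0 \<and> Q \<bullet> outer w = 0}"
  then obtain e where e: "0 < e" "\<And>w. w \<in> ball v e \<Longrightarrow> w $ k \<noteq> 0 \<Longrightarrow> Q \<bullet> outer w \<noteq> 0"
    unfolding closure_approachable by (auto simp: dist_commute not_less) (metis not_le)
  have vk: "v $ k = 0"
    using e zero by (metis centre_in_ball)
  obtain \<sigma> where \<sigma>: "\<sigma> = 1 \<or> \<sigma> = -1"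
      "\<And>w. w \<in> ball v e \<Longrightarrow> 0 \<le> 1 * w $ k \<Longrightarrow> 0 \<le> \<sigma> * (Q \<bullet> outer w)"
    by (rule half_ball_sign[of v e k Q 1, OF e(2)]) simp_all
  obtain \<tau> where \<tau>: "\<tau> = 1 \<or> \<tau> = -1"
      "\<And>w. w \<in> ball v e \<Longrightarrow> 0 \<le> -1 * w $ k \<Longrightarrow> 0 \<le> \<tau> * (Q \<bullet> outer w)"
    by (rule half_ball_sign[of v e k Q "-1", OF e(2)]) simp_all
  show False
  proof (cases "\<sigma> = \<tau>")
    case True
    have nn: "0 \<le> (\<sigma> *\<^sub>R Q) \<bullet> outer u" for u
    proof (rule nonneg_near_zero_imp_nonneg[of UNIV e _ v])
      show "0 \<le> (\<sigma> *\<^sub>R Q) \<bullet> outer (v + u)" if "v + u \<in> ball v e" for u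
        using \<sigma>(2)[OF that] \<tau>(2)[OF that] True by (cases "0 \<le> (v + u) $ k") auto
    qed (use e zero in auto)
    show False
      using nn[of a] nn[of b] indef \<sigma>(1) by auto
  next
    case False
    have sub: "subspace {u :: real^'k. u $ k = 0}"
      by (auto simp: subspace_def)
    have flat: "Q \<bullet> outer (v + u) = 0" if "v + u \<in> ball v e" "u $ k = 0" for u
      using \<sigma>(2)[OF that(1)] \<tau>(2)[OF that(1)] \<sigma>(1) \<tau>(1) that(2) vk False by auto
    have "0 \<le> Q \<bullet> outer w"
      by (rule nonneg_near_zero_imp_nonneg[OF sub e(1) zero]) (use flat nz in auto)
    moreover have "0 \<le> (- Q) \<bullet> outer w"
      by (rule nonneg_near_zero_imp_nonneg[OF sub e(1)]) (use flat nz zero in auto)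
    ultimately show False
      using nz by simp
  qed
qed

text \<open>
  Otherwise the form is negative off the hyperplane near \<open>v\<close>, hence nonpositive near \<open>v\<close> and zero
  at \<open>v\<close>; a local maximum with value \<open>0\<close> makes it nonpositive everywhere, against \<open>a\<close>.
\<close>

lemma nonneg_in_closure:
  fixes v :: "real^'k"
  assumes a: "0 < Q \<bullet> outer a" and v: "0 \<le> Q \<bullet> outer v"
  shows "v \<in> closure {w. w $ k \<noteq> 0 \<and> 0 \<le> Q \<bullet> outer w}"
proof (rule ccontr)
  assume "v \<notin> closure {w. w $ k \<noteq> 0 \<and> 0 \<le> Q \<bullet> outer w}"
  then obtain e where e: "0 < e" "\<And>w. w \<in> ball v e \<Longrightarrow> w $ k \<noteq> 0 \<Longrightarrow> Q \<bullet> outer w < 0"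
    unfolding closure_approachable by (auto simp: not_le not_less) (metis dist_commute not_le)
  have half: "0 \<le> (- Q) \<bullet> outer w" if "w \<in> ball v e" "0 \<le> s * w $ k" "s \<noteq> 0" for s w
    by (rule nonneg_on_half_ball[OF _ that(3,1,2)]) (use e(2) in \<open>force intro: less_imp_le\<close>)
  have neg: "0 \<le> (- Q) \<bullet> outer w" if "w \<in> ball v e" for w
    using half[OF that, of 1] half[OF that, of "-1"] by (cases "0 \<le> w $ k") auto
  have zero: "(- Q) \<bullet> outer v = 0"
    using neg[of v] e(1) v by simp
  have "0 \<le> (- Q) \<bullet> outer a"
    by (rule nonneg_near_zero_imp_nonneg[OF subspace_UNIV e(1) zero]) (use neg in auto)
  with a show False by simp
qed

text \<open>
  The definite matrix \<open>X\<close> leaves room to subtract a small multiple of \<open>uu\<^sup>T\<close>, and the rest is a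
  sum of matrices \<open>pp\<^sup>T\<close>. A nonnegative form that does not vanish at \<open>u\<close> would therefore have
  \<open>Q \<bullet> X > 0\<close>. Applied to \<open>Q\<close> and \<open>-Q\<close>, this yields the sign changes needed for the
  approximation lemmas from the values of the Riesz functional.
\<close>

lemma pos_def_exists_neg:
  fixes X Q :: "real^'k^'k"
  assumes sym: "\<And>i j. X $ i $ j = X $ j $ i" and pos: "\<And>v. v \<noteq> 0 \<Longrightarrow> 0 < X \<bullet> outer v"
    and "Q \<bullet> X \<le> 0" and u: "Q \<bullet> outer u \<noteq> 0"
  obtains b where "Q \<bullet> outer b < 0"
proof (rule ccontr)
  assume "\<not> thesis"
  then have nn: "0 \<le> Q \<bullet> outer v" for v
    using that not_le by blast
  obtain \<delta> where \<delta>: "\<delta> > 0" "\<And>Y v. dist X Y < \<delta> \<Longrightarrow> 0 \<le> Y \<bullet> outer v"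
    using pos_def_nbhd[OF pos] by blast
  define t where "t = \<delta> / (2 * (norm (outer u) + 1))"
  have t: "t > 0"
    using \<delta>(1) by (simp add: t_def add_nonneg_pos)
  have "t * norm (outer u) \<le> t * (norm (outer u) + 1)"
    using t by simp
  also have "\<dots> = \<delta> / 2"
    by (simp add: t_def field_simps add_nonneg_eq_0_iff)
  finally have "dist X (X - t *\<^sub>R outer u) < \<delta>"
    using t \<delta>(1) by (simp add: dist_norm)
  moreover have "(X - t *\<^sub>R outer u) $ i $ j = (X - t *\<^sub>R outer u) $ j $ i" for i j
    using sym[of i j] by (simp add: mult.commute)
  ultimately have "\<exists>p :: 'k \<Rightarrow> real^'k. X - t *\<^sub>R outer u = (\<Sum>j\<in>UNIV. outer (p j))"
    by (intro psd_eq_sum_outer_UNIV \<delta>(2))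
  then obtain p where p: "X - t *\<^sub>R outer u = (\<Sum>j\<in>UNIV. outer (p (j :: 'k)))"
    by blast
  have "0 \<le> (\<Sum>j\<in>UNIV. Q \<bullet> outer (p j))"
    using nn by (intro sum_nonneg)
  also have "\<dots> = Q \<bullet> (X - t *\<^sub>R outer u)"
    by (simp add: p inner_sum_right)
  also have "\<dots> = Q \<bullet> X - t * (Q \<bullet> outer u)"
    by (simp add: inner_diff_right)
  also have "\<dots> < 0"
    using \<open>Q \<bullet> X \<le> 0\<close> mult_pos_pos[OF t, of "Q \<bullet> outer u"] nn[of u] u by linarith
  finally show False by simp
qed

section \<open>Multi-indices of degree at most two as pairs of affine indices\<close>

text \<open>
  The multi-indices of the monomials \<open>1, x\<^sub>1, \<dots>, x\<^sub>n\<close>, which label the rows of the moment matrix.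
\<close>

definition affine_index :: "'n option \<Rightarrow> 'n::finite multi_index" where
  "affine_index i = (case i of None \<Rightarrow> 0 | Some j \<Rightarrow> Poly_Mapping.single j 1)"

definition homogenize :: "real^'n \<Rightarrow> real^('n option)" where
  "homogenize x = (\<chi> i. case i of None \<Rightarrow> 1 | Some j \<Rightarrow> x $ j)"

definition dehomogenize :: "real^('n option) \<Rightarrow> real^'n" where
  "dehomogenize v = (\<chi> j. v $ Some j / v $ None)"

lemma homogenize_dehomogenize:
  assumes "v $ None \<noteq> 0"
  shows "v = (v $ None) *\<^sub>R homogenize (dehomogenize v)"
  using assms by (auto simp: vec_eq_iff homogenize_def dehomogenize_def split: option.split)

lemma mdeg_add: "mdeg (\<alpha> + \<beta>) = mdeg \<alpha> + mdeg \<beta>"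
  by (simp add: mdeg_def lookup_add sum.distrib)

lemma mdeg_affine_index: "mdeg (affine_index i) = (if i = None then 0 else 1)"
  by (auto simp: mdeg_def affine_index_def lookup_single when_def split: option.split)

lemma mdeg_eq_0_iff: "mdeg \<alpha> = 0 \<longleftrightarrow> \<alpha> = 0"
  by (auto simp: mdeg_def intro: poly_mapping_eqI)

lemma inj_affine_index: "inj affine_index"
proof (rule injI)
  fix i j :: "'n::finite option"
  assume "affine_index i = affine_index j"
  then have "Poly_Mapping.lookup (affine_index i) k = Poly_Mapping.lookup (affine_index j) k" for k
    by simp
  from this[of "the i"] this[of "the j"] show "i = j"
    by (cases i; cases j) (auto simp: affine_index_def lookup_single when_def split: if_splits)
qed

text \<open>
  Splitting off one variable at a time, or the constant monomial when none is left, so that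
  \<open>d\<close> steps exhaust a monomial of degree at most \<open>d\<close>.
\<close>

lemma affine_index_decompose:
  assumes "mdeg \<alpha> \<le> Suc d"
  obtains i \<beta> where "mdeg \<beta> \<le> d" and "\<alpha> = affine_index i + \<beta>"
proof (cases "\<alpha> = 0")
  case True
  then show ?thesis
    using that[of 0 None] by (simp add: affine_index_def mdeg_def)
next
  case False
  then obtain j where j: "Poly_Mapping.lookup \<alpha> j \<noteq> 0"
    by (metis lookup_zero poly_mapping_eqI)
  define \<beta> where "\<beta> = \<alpha> - Poly_Mapping.single j 1"
  have eq: "\<alpha> = affine_index (Some j) + \<beta>"
    using j by (intro poly_mapping_eqI)
      (auto simp: \<beta>_def affine_index_def lookup_add lookup_minus lookup_single when_def)
  with assms have "mdeg \<beta> \<le> d"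
    by (simp add: mdeg_add mdeg_affine_index)
  with eq show ?thesis using that by blast
qed

lemma multi_indices_1: "multi_indices 1 = range affine_index"
proof -
  have "\<alpha> \<in> range affine_index" if "mdeg \<alpha> \<le> 1" for \<alpha> :: "'n::finite multi_index"
    using affine_index_decompose[of \<alpha> 0] that
    by (metis One_nat_def add_0_right le_zero_eq mdeg_eq_0_iff rangeI)
  then show ?thesis
    by (auto simp: multi_indices_def mdeg_affine_index)
qed

lemma mem_multi_indices_2:
  assumes "\<alpha> \<in> multi_indices 2"
  obtains i j where "\<alpha> = affine_index i + affine_index j"
proof -
  have "mdeg \<alpha> \<le> Suc 1"
    using assms by (simp add: multi_indices_def)
  then obtain i \<beta> where "mdeg \<beta> \<le> 1" "\<alpha> = affine_index i + \<beta>"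
    by (rule affine_index_decompose)
  moreover from this have "\<beta> \<in> range affine_index"
    using multi_indices_1 by (auto simp: multi_indices_def)
  ultimately show ?thesis using that by blast
qed

lemma affine_index_add_mem: "affine_index i + affine_index j \<in> multi_indices 2"
  by (simp add: multi_indices_def mdeg_add mdeg_affine_index)

lemma monomial_eval_affine_index_add:
  "monomial_eval (affine_index i + affine_index j) x = homogenize x $ i * homogenize x $ j"
proof -
  have "monomial_eval (affine_index i) x = homogenize x $ i" for i
    by (cases i) (simp_all add: monomial_eval_def affine_index_def homogenize_def lookup_single
        when_def if_distrib[of "\<lambda>k. _ ^ k"] cong: if_cong)
  moreover have "monomial_eval (\<alpha> + \<beta>) x = monomial_eval \<alpha> x * monomial_eval \<beta> x" for \<alpha> \<beta>
    by (simp add: monomial_eval_def lookup_add power_add prod.distrib)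
  ultimately show ?thesis by simp
qed

section \<open>Quadratic polynomials and moment sequences as symmetric matrices\<close>

definition hankel :: "('n::finite multi_index \<Rightarrow> real) \<Rightarrow> real^('n option)^('n option)" where
  "hankel f = (\<chi> i j. f (affine_index i + affine_index j))"

text \<open>
  A monomial can arise from several pairs of affine indices (\<open>x\<^sub>1x\<^sub>2\<close> from two, for example). Its
  coefficient is divided equally among these entries, which makes the matrix symmetric.
\<close>

definition coeff_matrix :: "'n::finite real_mpoly \<Rightarrow> real^('n option)^('n option)" where
  "coeff_matrix q = (\<chi> i j. Poly_Mapping.lookup q (affine_index i + affine_index j) /
     real (card {(k, l). affine_index k + affine_index l = affine_index i + (affine_index j :: 'n multi_index)}))"

text \<open>
  Grouping the entries by the monomial that they stand for undoes the division by the number of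
  pairs. The identity is used twice: with the sequence \<open>y\<close> it computes the Riesz functional, and
  with the moments of the point mass at \<open>x\<close> it computes \<open>q(x)\<close>.
\<close>

lemma coeff_matrix_inner_hankel:
  fixes q :: "'n::finite real_mpoly"
  shows "coeff_matrix q \<bullet> hankel f = riesz 2 f q"
proof -
  let ?s = "\<lambda>(i, j). affine_index i + affine_index j :: 'n multi_index"
  define N where "N \<alpha> = {p. ?s p = \<alpha>}" for \<alpha>
  define h where "h p = Poly_Mapping.lookup q (?s p) / real (card (N (?s p))) * f (?s p)" for p
  have N: "{(k, l). affine_index k + affine_index l = \<alpha>} = N \<alpha>" for \<alpha> :: "'n multi_index"
    by (auto simp: N_def)
  have "coeff_matrix q \<bullet> hankel f = (\<Sum>p\<in>UNIV. h p)"
    by (simp add: coeff_matrix_def hankel_def inner_vec_def h_def N sum.cartesian_product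
        UNIV_Times_UNIV[symmetric] case_prod_beta del: UNIV_Times_UNIV)
  also have "\<dots> = (\<Sum>\<alpha>\<in>multi_indices 2. \<Sum>p\<in>{p \<in> UNIV. ?s p = \<alpha>}. h p)"
    by (intro sum.group[symmetric] finite_multi_indices) (auto simp: affine_index_add_mem)
  also have "\<dots> = (\<Sum>\<alpha>\<in>multi_indices 2. Poly_Mapping.lookup q \<alpha> * f \<alpha>)"
  proof (rule sum.cong[OF refl])
    fix \<alpha> :: "'n multi_index" assume "\<alpha> \<in> multi_indices 2"
    then have "N \<alpha> \<noteq> {}"
      by (elim mem_multi_indices_2) (auto simp: N_def)
    then have "card (N \<alpha>) \<noteq> 0"
      by (simp add: card_eq_0_iff)
    have "(\<Sum>p\<in>{p \<in> UNIV. ?s p = \<alpha>}. h p)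
        = (\<Sum>p\<in>N \<alpha>. Poly_Mapping.lookup q \<alpha> / real (card (N \<alpha>)) * f \<alpha>)"
      by (intro sum.cong) (auto simp: N_def h_def)
    also have "\<dots> = Poly_Mapping.lookup q \<alpha> * f \<alpha>"
      using \<open>card (N \<alpha>) \<noteq> 0\<close> by simp
    finally show "(\<Sum>p\<in>{p \<in> UNIV. ?s p = \<alpha>}. h p) = Poly_Mapping.lookup q \<alpha> * f \<alpha>" .
  qed
  finally show ?thesis
    by (simp add: riesz_def)
qed

lemma mpoly_eval_eq_inner_outer:
  assumes "quadratic q"
  shows "mpoly_eval q x = coeff_matrix q \<bullet> outer (homogenize x)"
proof -
  have "outer (homogenize x) = hankel (\<lambda>\<alpha>. monomial_eval \<alpha> x)"
    by (simp add: vec_eq_iff hankel_def monomial_eval_affine_index_add)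
  then have "coeff_matrix q \<bullet> outer (homogenize x) = riesz 2 (\<lambda>\<alpha>. monomial_eval \<alpha> x) q"
    by (simp add: coeff_matrix_inner_hankel)
  also have "\<dots> = mpoly_eval q x"
    unfolding riesz_def mpoly_eval_def
  proof (intro sum.mono_neutral_right finite_multi_indices ballI)
    have "mdeg \<alpha> \<le> total_deg q" if "\<alpha> \<in> Poly_Mapping.keys q" for \<alpha>
      using that unfolding total_deg_def by (intro Max_ge) auto
    then show "Poly_Mapping.keys q \<subseteq> multi_indices 2"
      using assms by (auto simp: quadratic_def multi_indices_def)
  qed (simp add: in_keys_iff)
  finally show ?thesis by simp
qed

text \<open>
  On the hyperplane \<open>w\<^sub>0 = 0\<close> the form is the homogeneous part of degree two of \<open>q\<close>. If it vanished
  there, polarisation on the basis vectors would make all coefficients of degree two vanish.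
\<close>

lemma quadratic_form_at_infinity:
  fixes q :: "'n::finite real_mpoly"
  assumes "quadratic q"
  shows "\<exists>w. w $ None = 0 \<and> coeff_matrix q \<bullet> outer w \<noteq> 0"
proof (rule ccontr)
  assume "\<not> ?thesis"
  then have zero: "coeff_matrix q \<bullet> outer w = 0" if "w $ None = 0" for w
    using that by blast
  have sym: "coeff_matrix q $ i $ j = coeff_matrix q $ j $ i" for i j
    by (simp add: coeff_matrix_def add.commute)
  have coeff: "coeff_matrix q $ Some i $ Some j = 0" for i j
  proof -
    have ax: "axis (Some l) 1 $ None = (0 :: real)" for l :: 'n
      by (simp add: axis_def)
    have "coeff_matrix q $ Some i $ Some i = 0"
      using inner_outer_add_axis[OF sym, of 0 1 "Some i"] zero ax by simp
    moreover have "coeff_matrix q $ Some i \<bullet> axis (Some j) 1 = 0"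
      using inner_outer_add_axis[OF sym, of "axis (Some j) 1" 1 "Some i"] zero ax calculation
      by simp
    ultimately show ?thesis
      by (simp add: inner_axis)
  qed
  have "Max (insert 0 (mdeg ` Poly_Mapping.keys q)) \<in> insert 0 (mdeg ` Poly_Mapping.keys q)"
    by (intro Max_in) auto
  then obtain \<alpha> where \<alpha>: "\<alpha> \<in> Poly_Mapping.keys q" "mdeg \<alpha> = 2"
    using assms unfolding quadratic_def total_deg_def by auto
  then obtain i j where ij: "\<alpha> = affine_index i + affine_index j"
    using mem_multi_indices_2[of \<alpha>] by (auto simp: multi_indices_def)
  with \<alpha>(2) obtain i' j' where "i = Some i'" "j = Some j'"
    by (cases i; cases j) (auto simp: mdeg_add mdeg_affine_index)
  \<comment> \<open>the matrix entry is a nonzero coefficient divided by a number of pairs, so it vanishes only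
    through division by zero\<close>
  with coeff[of i' j'] ij \<alpha>(1) have "{(k, l). affine_index k + affine_index l = \<alpha>} = {}"
    by (auto simp: coeff_matrix_def in_keys_iff)
  with ij show False by auto
qed

section \<open>From convex combinations to representing measures\<close>

text \<open>
  A summand \<open>c vv\<^sup>T\<close> with \<open>v\<^sub>0 \<noteq> 0\<close> becomes an atom of mass \<open>c v\<^sub>0\<^sup>2\<close> at the point \<open>v/v\<^sub>0\<close>. The atoms
  are indexed by the summands, and the measure is pushed forward to \<open>\<real>\<^sup>n\<close>, so that coinciding
  points need no special treatment.
\<close>

lemma convex_hull_imp_representable:
  fixes q :: "'n::finite real_mpoly"
  assumes q: "quadratic q" and y: "y \<in> trunc_moment_seqs 2" and T: "T = {0} \<or> T = {0..}"
    and hull: "hankel y \<in> convex hull (outer ` {v. v $ None \<noteq> 0 \<and> coeff_matrix q \<bullet> outer v \<in> T})"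
  shows "y \<in> representable 2 {x. mpoly_eval q x \<in> T}"
proof -
  let ?W = "{v. v $ None \<noteq> 0 \<and> coeff_matrix q \<bullet> outer v \<in> T}"
  obtain m :: nat and c X where cX: "\<forall>i\<in>{1..m}. 0 \<le> c i \<and> X i \<in> outer ` ?W"
      "hankel y = (\<Sum>i\<in>{1..m}. c i *\<^sub>R X i)"
    using hull unfolding convex_hull_indexed by auto
  then have "\<forall>i\<in>{1..m}. \<exists>v. v \<in> ?W \<and> X i = outer v" by blast
  from bchoice[OF this] obtain v
    where v: "\<And>i. i \<in> {1..m} \<Longrightarrow> v i \<in> ?W" "\<And>i. i \<in> {1..m} \<Longrightarrow> X i = outer (v i)"
    by blast
  define p where "p i = dehomogenize (v i)" for i
  define g where "g i = c i * (v i $ None)\<^sup>2" for i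
  have outer_v: "outer (v i) = (v i $ None)\<^sup>2 *\<^sub>R outer (homogenize (p i))" if "i \<in> {1..m}" for i
    unfolding p_def outer_scaleR[symmetric]
    using v(1)[OF that] by (subst homogenize_dehomogenize[of "v i", symmetric]) simp_all
  have p: "mpoly_eval q (p i) \<in> T" if "i \<in> {1..m}" for i
  proof -
    have "v i $ None \<noteq> 0" "coeff_matrix q \<bullet> outer (v i) \<in> T"
      using v(1)[OF that] by simp_all
    then have "0 < (v i $ None)\<^sup>2" "(v i $ None)\<^sup>2 * mpoly_eval q (p i) \<in> T"
      by (simp_all add: outer_v[OF that] mpoly_eval_eq_inner_outer[OF q])
    then show ?thesis
      using T zero_le_mult_iff[of "(v i $ None)\<^sup>2" "mpoly_eval q (p i)"] by auto
  qed
  have g: "0 \<le> g i" if "i \<in> {1..m}" for i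
    using cX(1) that by (simp add: g_def)
  define P where "P = point_measure {1..m} (\<lambda>i. ennreal (g i))"
  define \<mu> where "\<mu> = distr P borel p"
  have meas: "p \<in> measurable P borel"
    by (simp add: P_def measurable_point_measure_eq1)
  have "has_bochner_integral \<mu> (monomial_eval \<alpha>) (y \<alpha>)" if \<alpha>: "\<alpha> \<in> multi_indices 2" for \<alpha>
  proof -
    obtain i j where ij: "\<alpha> = affine_index i + affine_index j"
      using mem_multi_indices_2[OF \<alpha>] .
    have "y \<alpha> = hankel y $ i $ j"
      by (simp add: hankel_def ij)
    also have "\<dots> = (\<Sum>l\<in>{1..m}. g l * monomial_eval \<alpha> (p l))"
    proof -
      have "c l * (X l $ i $ j) = g l * monomial_eval \<alpha> (p l)" if "l \<in> {1..m}" for l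
        unfolding v(2)[OF that] outer_v[OF that]
        by (simp add: g_def ij monomial_eval_affine_index_add)
      then show ?thesis
        unfolding cX(2) by simp
    qed
    also have "\<dots> = (LINT l|P. monomial_eval \<alpha> (p l))"
      unfolding P_def using g by (subst lebesgue_integral_point_measure_finite) auto
    finally have "has_bochner_integral P (\<lambda>l. monomial_eval \<alpha> (p l)) (y \<alpha>)"
      by (simp add: has_bochner_integral_iff P_def integrable_point_measure_finite)
    moreover have "monomial_eval \<alpha> \<in> borel_measurable borel"
      unfolding monomial_eval_def by (intro borel_measurable_continuous_onI continuous_intros)
    ultimately show ?thesis
      unfolding \<mu>_def using meas by (intro has_bochner_integral_distr) auto
  qed
  moreover have "emeasure \<mu> (- {x. mpoly_eval q x \<in> T}) = 0"
  proof -
    have "p -` (- {x. mpoly_eval q x \<in> T}) \<inter> space P = {}"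
      using p by (auto simp: P_def space_point_measure)
    \<comment> \<open>a set that is not Borel has measure zero by convention\<close>
    then show ?thesis
      using meas by (cases "- {x. mpoly_eval q x \<in> T} \<in> sets borel")
        (simp_all add: \<mu>_def emeasure_distr emeasure_notin_sets)
  qed
  ultimately show ?thesis
    using y unfolding representable_def \<mu>_def
    by (intro CollectI conjI exI[of _ "distr P borel p"]) auto
qed

lemma pos_definite_hankel:
  assumes "pos_definite_on (multi_indices 1) (moment_matrix y)" and "v \<noteq> 0"
  shows "0 < hankel y \<bullet> outer v"
proof -
  define u where "u \<alpha> = v $ (inv affine_index \<alpha>)" for \<alpha>
  have u: "u (affine_index i) = v $ i" for i
    by (simp add: u_def inv_f_f inj_affine_index)
  obtain i where "v $ i \<noteq> 0"
    using \<open>v \<noteq> 0\<close> by (auto simp: vec_eq_iff)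
  then have "\<exists>\<alpha>\<in>multi_indices 1. u \<alpha> \<noteq> 0"
    using u unfolding multi_indices_1 by auto
  with assms(1) have "0 < (\<Sum>\<alpha>\<in>multi_indices 1. \<Sum>\<beta>\<in>multi_indices 1. u \<alpha> * moment_matrix y \<alpha> \<beta> * u \<beta>)"
    unfolding pos_definite_on_def by blast
  also have "\<dots> = hankel y \<bullet> outer v"
    unfolding multi_indices_1
    by (simp add: sum.reindex[OF inj_affine_index] o_def u moment_matrix_def
        inner_vec_def hankel_def mult_ac)
  finally show ?thesis .
qed

section \<open>Quadratic moment problems on quadratic sets\<close>

theorem theorem4p10:
  fixes y :: "'n::finite multi_index \<Rightarrow> real" and q :: "'n real_mpoly"
  assumes "y \<in> trunc_moment_seqs 2" and "quadratic q"
  shows "(zero_set q \<noteq> {} \<and> pos_definite_on (multi_indices 1) (moment_matrix y) \<and> riesz 2 y q = 0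
            \<longrightarrow> y \<in> representable 2 (zero_set q)) \<and>
         (nonneg_set q \<noteq> {} \<and> pos_definite_on (multi_indices 1) (moment_matrix y) \<and> riesz 2 y q > 0
            \<longrightarrow> y \<in> representable 2 (nonneg_set q))"
proof (intro conjI impI; elim conjE)
  let ?Q = "coeff_matrix q" and ?X = "hankel y"
  have sym: "?X $ i $ j = ?X $ j $ i" for i j
    by (simp add: hankel_def add.commute)
  obtain w where w: "w $ None = 0" "?Q \<bullet> outer w \<noteq> 0"
    using quadratic_form_at_infinity[OF assms(2)] by blast
  {
    assume "pos_definite_on (multi_indices 1) (moment_matrix y)" and "riesz 2 y q = 0"
    then have pos: "\<And>v. v \<noteq> 0 \<Longrightarrow> 0 < ?X \<bullet> outer v" and zero: "?Q \<bullet> ?X = 0"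
      by (simp_all add: pos_definite_hankel coeff_matrix_inner_hankel)
    obtain a where "0 < ?Q \<bullet> outer a"
      using pos_def_exists_neg[OF sym pos, of "- ?Q" w] zero w by auto
    moreover obtain b where "?Q \<bullet> outer b < 0"
      using pos_def_exists_neg[OF sym pos, of ?Q w] zero w by auto
    ultimately have "v \<in> closure {w. w $ None \<noteq> 0 \<and> ?Q \<bullet> outer w \<in> {0}}"
      if "?Q \<bullet> outer v \<in> {0}" for v
      using isotropic_in_closure[of ?Q a b w None v] w that by simp
    then have "?X \<in> convex hull (outer ` {v. v $ None \<noteq> 0 \<and> ?Q \<bullet> outer v \<in> {0}})"
      using zero by (intro pos_def_mem_convex_hull sym pos) auto
    then show "y \<in> representable 2 (zero_set q)"
      using convex_hull_imp_representable[OF assms(2,1), of "{0}"] by (simp add: zero_set_def)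
  }
  {
    assume "pos_definite_on (multi_indices 1) (moment_matrix y)" and "0 < riesz 2 y q"
    then have pos: "\<And>v. v \<noteq> 0 \<Longrightarrow> 0 < ?X \<bullet> outer v" and gt: "0 < ?Q \<bullet> ?X"
      by (simp_all add: pos_definite_hankel coeff_matrix_inner_hankel)
    obtain a where "0 < ?Q \<bullet> outer a"
      using pos_def_exists_neg[OF sym pos, of "- ?Q" w] gt w by auto
    then have "v \<in> closure {w. w $ None \<noteq> 0 \<and> ?Q \<bullet> outer w \<in> {0..}}"
      if "?Q \<bullet> outer v \<in> {0..}" for v
      using nonneg_in_closure[of ?Q a v None] that by simp
    then have "?X \<in> convex hull (outer ` {v. v $ None \<noteq> 0 \<and> ?Q \<bullet> outer v \<in> {0..}})"
      using gt by (intro pos_def_mem_convex_hull sym pos) auto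
    then show "y \<in> representable 2 (nonneg_set q)"
      using convex_hull_imp_representable[OF assms(2,1), of "{0..}"] by (simp add: nonneg_set_def)
  }
qed

end
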